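(* For coprime positive integers $a,b$ and $i=0,\ldots,a-1$, the number $\mathtt{sch}(a,b,i)$ of (small) $(a,b)$-Schröder paths with exactly $i$ diagonal steps is $$\mathtt{sch}(a,b,i) = \frac{1}{a}\binom{b-1}{i}\binom{a+b-1-i}{b} = \frac{1}{b}\binom{a-1}{i}\binom{a+b-1-i}{a}.$$
   Context: A lattice path from $(0,0)$ to $(b,a)$ is a sequence of $a$ north steps $N=(0,1)$ and $b$ east steps $E=(1,0)$. For coprime positive integers $a,b$, let $\nu(a,b)$ be the unique lowest lattice path from $(0,0)$ to $(b,a)$ that stays weakly above the line segment from $(0,0)$ to $(b,a)$. A (small) $(a,b)$-Schröder path is a path from $(0,0)$ to $(b,a)$ with steps $N$, $E$, $D=(1,1)$ (diagonal) which stays weakly above $\nu(a,b)$. Binomial coefficients $\binom{n}{k}$ with $k>n\ge 0$ are $0$. *)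

theory Defs
  imports "HOL-Analysis.Analysis"
begin

datatype step = North | East | Diag

fun step_vec :: "step \<Rightarrow> real \<times> real" where
  "step_vec North = (0, 1)"
| "step_vec East = (1, 0)"
| "step_vec Diag = (1, 1)"

text \<open>The planar curve traced out by a path starting at the point \<open>p\<close>.\<close>

fun path_curve_from :: "real \<times> real \<Rightarrow> step list \<Rightarrow> (real \<times> real) set" where
  "path_curve_from p [] = {p}"
| "path_curve_from p (s # ss) =
     closed_segment p (p + step_vec s) \<union> path_curve_from (p + step_vec s) ss"

abbreviation path_curve :: "step list \<Rightarrow> (real \<times> real) set" where
  "path_curve \<equiv> path_curve_from (0, 0)"

text \<open>Every point of \<open>A\<close> lies on or vertically above some point of \<open>B\<close>. The comparison is made
  at all points of the curve, not only at lattice points: a diagonal step that cuts below a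
  North-East corner of \<open>B\<close> has both endpoints on \<open>B\<close> but is not weakly above \<open>B\<close>. Over a
  vertical piece of \<open>B\<close> the condition refers to its lowest point.\<close>

definition weakly_above :: "(real \<times> real) set \<Rightarrow> (real \<times> real) set \<Rightarrow> bool" where
  "weakly_above A B \<longleftrightarrow> (\<forall>(x, y) \<in> A. \<exists>y' \<le> y. (x, y') \<in> B)"

definition lattice_path :: "nat \<Rightarrow> nat \<Rightarrow> step list \<Rightarrow> bool" where
  "lattice_path a b p \<longleftrightarrow>
     set p \<subseteq> {North, East} \<and> count_list p North = a \<and> count_list p East = b"

definition above_segment :: "nat \<Rightarrow> nat \<Rightarrow> step list \<Rightarrow> bool" where
  "above_segment a b p \<longleftrightarrow>
     lattice_path a b p \<and> weakly_above (path_curve p) (closed_segment (0, 0) (real b, real a))"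

definition nu :: "nat \<Rightarrow> nat \<Rightarrow> step list" where
  "nu a b = (THE p. above_segment a b p \<and>
                    (\<forall>q. above_segment a b q \<longrightarrow> weakly_above (path_curve q) (path_curve p)))"

definition schroeder_path :: "nat \<Rightarrow> nat \<Rightarrow> step list \<Rightarrow> bool" where
  "schroeder_path a b p \<longleftrightarrow>
     sum_list (map step_vec p) = (real b, real a) \<and> weakly_above (path_curve p) (path_curve (nu a b))"

definition sch :: "nat \<Rightarrow> nat \<Rightarrow> nat \<Rightarrow> nat" where
  "sch a b i = card {p. schroeder_path a b p \<and> count_list p Diag = i}"

end

theory Submission
  imports Defs
begin

text \<open>
  A path is weakly above a north-east path iff, in every column, its step across that column starts
  at least as high as the east step there. Since \<open>nu\<close> crosses column \<open>k\<close> at height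
  \<open>\<lceil>a (k + 1) / b\<rceil>\<close>, a Schroeder path is a rational Dyck path some of whose valleys \<open>EN\<close> are
  marked, a marked valley standing for a diagonal step. Record for each column the number of north
  steps before its crossing and a mark. If the first column may be marked as well, these data are
  closed under rotation; by the cycle lemma exactly one of the \<open>b\<close> rotations is a Dyck
  path, so there are \<open>1/b (b choose i) (a + b - 1 - i choose b - 1)\<close> marked Dyck paths with \<open>i\<close>
  marks. Those whose first column is marked correspond, by erasing that mark, to Schroeder paths
  with \<open>i - 1\<close> diagonals. Hence \<open>sch i + sch (i - 1)\<close> is known, and induction on \<open>i\<close> finishes.
\<close>

subsection \<open>Comparison of path curves by columns\<close>

text \<open>The heights at which the steps crossing the successive columns start.\<close>

fun cols :: "nat \<Rightarrow> step list \<Rightarrow> nat list" where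
  "cols n [] = []"
| "cols n (North # p) = cols (Suc n) p"
| "cols n (East # p) = n # cols n p"
| "cols n (Diag # p) = n # cols (Suc n) p"

lemma length_cols: "length (cols n p) = count_list p East + count_list p Diag"
  by (induction n p rule: cols.induct) auto

lemma cols_append:
  "cols n (p @ q) = cols n p @ cols (n + count_list p North + count_list p Diag) q"
  by (induction n p rule: cols.induct) auto

lemma cols_lower: "y \<in> set (cols n p) \<Longrightarrow> n \<le> y"
  by (induction n p rule: cols.induct) (auto dest: Suc_leD)

lemma cols_upper: "y \<in> set (cols n p) \<Longrightarrow> y \<le> n + count_list p North + count_list p Diag"
  by (induction n p rule: cols.induct) auto

text \<open>Differences of successive heights give the north steps before each east step, and the
  total count of \<open>North\<close> fixes those after the last one.\<close>

lemma lattice_path_eqI: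
  assumes "Diag \<notin> set p" "Diag \<notin> set q" "cols n p = cols n q"
    "count_list p North = count_list q North"
  shows "p = q"
  using assms
proof (induction n p arbitrary: q rule: cols.induct)
  case (1 n)
  then show ?case
    by (cases q; cases "hd q") (auto simp: length_cols dest!: arg_cong[of "[]" _ length])
next
  case (2 n p)
  \<comment> \<open>Once the height has passed \<open>n\<close>, no later column starts at
    \<open>n\<close>; this excludes \<open>East\<close> as the first step of
    \<open>q\<close>.\<close>
  have "n \<notin> set (cols (Suc n) p)" using cols_lower[of n "Suc n" p] by auto
  then show ?case using 2 by (cases q; cases "hd q") auto
next
  case (3 n p)
  have "n \<notin> set (cols (Suc n) (tl q))" using cols_lower[of n "Suc n" "tl q"] by auto
  then have "n # cols n p \<noteq> cols (Suc n) (tl q)" by (metis list.set_intros(1))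
  then obtain q' where q: "q = East # q'"
    using 3(3,4) by (cases q; cases "hd q") auto
  then have "p = q'" by (intro "3.IH") (use 3(2-5) in auto)
  then show ?case using q by simp
qed auto

lemma sum_list_step_vec:
  "sum_list (map step_vec p) = (real (length (cols n p)), real (count_list p North + count_list p Diag))"
  by (induction n p rule: cols.induct) (auto simp: zero_prod_def)

lemma mem_closed_segment_step:
  "(x, y) \<in> closed_segment (p, q) ((p, q) + step_vec s) \<longleftrightarrow>
    (\<exists>t. 0 \<le> t \<and> t \<le> 1 \<and> x = p + t * fst (step_vec s) \<and> y = q + t * snd (step_vec s))"
  by (cases s) (simp_all add: closed_segment_def algebra_simps conj_ac)

lemma path_curve_fst_bounds:
  assumes "(x, y) \<in> path_curve_from (real m, real n) p"
  shows "real m \<le> x \<and> x \<le> real (m + length (cols n p))"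
  using assms
proof (induction p arbitrary: m n)
  case (Cons s p)
  show ?case
    using Cons.prems Cons.IH[of m "Suc n"] Cons.IH[of "Suc m" n] Cons.IH[of "Suc m" "Suc n"]
    unfolding path_curve_from.simps Un_iff mem_closed_segment_step
    by (cases s) (auto simp: add.commute)
qed simp

text \<open>On each \<open>(k, k + 1]\<close>, the region above a lattice path is bounded by a constant, and the region
  above a segment by an increasing function. Diagonal steps need the stronger hypothesis, since a
  diagonal can climb along with an increasing boundary.\<close>

lemma path_curve_above_iff:
  fixes G :: "real \<Rightarrow> real"
  assumes "\<And>k x. real k < x \<Longrightarrow> x \<le> real (Suc k) \<Longrightarrow> G x \<le> G (real (Suc k))"
    and "\<And>k x. Diag \<in> set p \<Longrightarrow> real k < x \<Longrightarrow> x \<le> real (Suc k) \<Longrightarrow> G x = G (real (Suc k))"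
  shows "(\<forall>(x, y) \<in> path_curve_from (real m, real n) p. G x \<le> y) \<longleftrightarrow>
    G (real m) \<le> real n \<and> (\<forall>k < length (cols n p). G (real (Suc (m + k))) \<le> real (cols n p ! k))"
  using assms(2)
proof (induction p arbitrary: m n)
  case (Cons s p)
  have seg: "(\<forall>(x, y) \<in> closed_segment (real m, real n) ((real m, real n) + step_vec s). G x \<le> y) \<longleftrightarrow>
    (\<forall>t. 0 \<le> t \<and> t \<le> 1 \<longrightarrow> G (real m + t * fst (step_vec s)) \<le> real n + t * snd (step_vec s))"
    by (fastforce simp: mem_closed_segment_step)
  have IH: "(\<forall>(x, y) \<in> path_curve_from (real m, real n) p. G x \<le> y) \<longleftrightarrow>
    G (real m) \<le> real n \<and> (\<forall>k < length (cols n p). G (real (Suc (m + k))) \<le> real (cols n p ! k))" for m n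
    using Cons by auto
  show ?case
  proof (cases s)
    case North
    have "(\<forall>t. 0 \<le> t \<and> t \<le> 1 \<longrightarrow> G (real m) \<le> real n + t) \<longleftrightarrow> G (real m) \<le> real n"
      by (auto dest: spec[of _ 0])
    with seg North have "(\<forall>(x, y) \<in> closed_segment (real m, real n) ((real m, real n) + step_vec s). G x \<le> y) \<longleftrightarrow>
        G (real m) \<le> real n" by simp
    moreover have "(real m, real n) + step_vec s = (real m, real (Suc n))" using North by simp
    ultimately show ?thesis
      using IH[of m "Suc n"] North unfolding path_curve_from.simps ball_Un
      by (simp only: cols.simps) auto
  next
    case East
    have "(\<forall>t. 0 \<le> t \<and> t \<le> 1 \<longrightarrow> G (real m + t) \<le> real n) \<longleftrightarrow>
      G (real m) \<le> real n \<and> G (real (Suc m)) \<le> real n" (is "?L \<longleftrightarrow> ?R")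
    proof
      assume ?L
      from this[rule_format, of 0] this[rule_format, of 1] show ?R by (simp add: add.commute)
    next
      assume R: ?R
      show ?L
      proof (intro allI impI)
        fix t :: real assume t: "0 \<le> t \<and> t \<le> 1"
        show "G (real m + t) \<le> real n"
          using R t assms(1)[of m "real m + t"] by (cases "t = 0") auto
      qed
    qed
    with seg East have "(\<forall>(x, y) \<in> closed_segment (real m, real n) ((real m, real n) + step_vec s). G x \<le> y) \<longleftrightarrow>
        G (real m) \<le> real n \<and> G (real (Suc m)) \<le> real n" by simp
    moreover have "(real m, real n) + step_vec s = (real (Suc m), real n)" using East by simp
    moreover have "cols n (s # p) = n # cols n p" using East by simp
    ultimately show ?thesis
      using IH[of "Suc m" n] unfolding path_curve_from.simps ball_Un
      by (simp only: length_Cons All_less_Suc2 nth_Cons_0 nth_Cons_Suc add_0_right add_Suc add_Suc_right) blast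
  next
    case Diag
    have "(\<forall>t. 0 \<le> t \<and> t \<le> 1 \<longrightarrow> G (real m + t) \<le> real n + t) \<longleftrightarrow>
      G (real m) \<le> real n \<and> G (real (Suc m)) \<le> real n" (is "?L \<longleftrightarrow> ?R")
    proof
      assume L: ?L
      \<comment> \<open>\<open>G\<close> is constant on the half-open column, so its value there
        bounds the diagonal just to the right of its start, where the height is still close to
        \<open>n\<close>. This is what forbids cutting a corner.\<close>
      have "G (real (Suc m)) \<le> real n + e" if "e > 0" for e
      proof -
        have "0 < min e 1" "min e 1 \<le> 1" using that by auto
        then show ?thesis
          using L[rule_format, of "min e 1"] Cons.prems[of m "real m + min e 1"] Diag
          by simp
      qed
      then have "G (real (Suc m)) \<le> real n" by (rule field_le_epsilon)
      with L[rule_format, of 0] show ?R by simp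
    next
      assume R: ?R
      show ?L
      proof (intro allI impI)
        fix t :: real assume t: "0 \<le> t \<and> t \<le> 1"
        show "G (real m + t) \<le> real n + t"
          using R t assms(1)[of m "real m + t"] by (cases "t = 0") auto
      qed
    qed
    with seg Diag have "(\<forall>(x, y) \<in> closed_segment (real m, real n) ((real m, real n) + step_vec s). G x \<le> y) \<longleftrightarrow>
        G (real m) \<le> real n \<and> G (real (Suc m)) \<le> real n" by simp
    moreover have "(real m, real n) + step_vec s = (real (Suc m), real (Suc n))" using Diag by simp
    moreover have "cols n (s # p) = n # cols (Suc n) p" using Diag by simp
    \<comment> \<open>Supplies the condition on the starting point in the induction hypothesis at
      height \<open>Suc n\<close>.\<close>
    moreover have "G (real (Suc m)) \<le> real n \<Longrightarrow> G (real (Suc m)) \<le> real (Suc n)" by simp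
    ultimately show ?thesis
      using IH[of "Suc m" "Suc n"] unfolding path_curve_from.simps ball_Un
      by (simp only: length_Cons All_less_Suc2 nth_Cons_0 nth_Cons_Suc add_0_right add_Suc add_Suc_right) blast
  qed
qed simp

text \<open>At an integer abscissa beyond \<open>m\<close> the lowest point of the curve is the end
  of the east step on its left. Hence columns are open on the left and closed on the right, the
  ceiling selects the column, and \<open>x = m\<close> is a separate case.\<close>

lemma above_path_curve_iff:
  assumes "Diag \<notin> set q"
  shows "(\<exists>y' \<le> y. (x, y') \<in> path_curve_from (real m, real n) q) \<longleftrightarrow>
    real m \<le> x \<and> x \<le> real (m + length (cols n q)) \<and>
    (if x = real m then real n else real (cols n q ! (nat \<lceil>x - real m\<rceil> - 1))) \<le> y"
  using assms
proof (induction q arbitrary: m n)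
  case (Cons s q)
  have split: "(\<exists>y' \<le> y. (x, y') \<in> A \<union> B) \<longleftrightarrow>
      (\<exists>y' \<le> y. (x, y') \<in> A) \<or> (\<exists>y' \<le> y. (x, y') \<in> B)" for A B :: "(real \<times> real) set"
    by blast
  show ?case
  proof (cases s)
    case North
    have "(\<exists>y' \<le> y. (x, y') \<in> closed_segment (real m, real n) ((real m, real n) + step_vec s)) \<longleftrightarrow>
        x = real m \<and> real n \<le> y"
      unfolding mem_closed_segment_step North by (auto intro: exI[of _ 0])
    moreover have "(real m, real n) + step_vec s = (real m, real (Suc n))" using North by simp
    ultimately show ?thesis
      using Cons.IH[of m "Suc n"] Cons.prems North unfolding path_curve_from.simps split
      by (simp only: cols.simps) auto
  next
    case East
    have "(\<exists>y' \<le> y. (x, y') \<in> closed_segment (real m, real n) ((real m, real n) + step_vec s)) \<longleftrightarrow>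
        real m \<le> x \<and> x \<le> real m + 1 \<and> real n \<le> y" (is "?L \<longleftrightarrow> ?R")
    proof
      assume ?R
      then have "(x, real n) \<in> closed_segment (real m, real n) ((real m, real n) + step_vec s)"
        unfolding mem_closed_segment_step East by (intro exI[of _ "x - real m"]) simp
      with \<open>?R\<close> show ?L by blast
    qed (unfold mem_closed_segment_step East, auto)
    moreover have "(real m, real n) + step_vec s = (real (Suc m), real n)" using East by simp
    moreover have "(\<exists>y' \<le> y. (x, y') \<in> path_curve_from (real (Suc m), real n) q) \<longleftrightarrow>
        real (Suc m) \<le> x \<and> x \<le> real (Suc m + length (cols n q)) \<and>
        (if x = real (Suc m) then real n else real (cols n q ! (nat \<lceil>x - real (Suc m)\<rceil> - 1))) \<le> y"
      by (rule Cons.IH) (use Cons.prems in simp)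
    ultimately have *: "(\<exists>y' \<le> y. (x, y') \<in> path_curve_from (real m, real n) (s # q)) \<longleftrightarrow>
        real m \<le> x \<and> x \<le> real m + 1 \<and> real n \<le> y \<or>
        real (Suc m) \<le> x \<and> x \<le> real (Suc m + length (cols n q)) \<and>
        (if x = real (Suc m) then real n else real (cols n q ! (nat \<lceil>x - real (Suc m)\<rceil> - 1))) \<le> y"
      unfolding path_curve_from.simps split by (simp only:)
    show ?thesis
    proof (cases "x \<le> real m + 1")
      case True
      then have "nat \<lceil>x - real m\<rceil> - 1 = 0" by linarith
      with True show ?thesis unfolding * using East by auto
    next
      case False
      then have "nat \<lceil>x - real m\<rceil> - 1 = Suc (nat \<lceil>x - real (Suc m)\<rceil> - 1)" by linarith
      with False show ?thesis unfolding * using East by auto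
    qed
  next
    case Diag
    with Cons.prems show ?thesis by simp
  qed
qed auto

text \<open>The lower boundary \<open>G\<close> of the region above \<open>q\<close> is constant on
  each half-open column, so both hypotheses of \<open>path_curve_above_iff\<close> hold, also when
  \<open>p\<close> has diagonals.\<close>

lemma weakly_above_path_iff:
  assumes "Diag \<notin> set q" "length (cols 0 p) = length (cols 0 q)"
  shows "weakly_above (path_curve p) (path_curve q) \<longleftrightarrow>
    (\<forall>k < length (cols 0 p). cols 0 q ! k \<le> cols 0 p ! k)"
proof -
  define G where "G = (\<lambda>x::real. if x = 0 then 0 else real (cols 0 q ! (nat \<lceil>x\<rceil> - 1)))"
  have G: "G x = real (cols 0 q ! k)" if "real k < x" "x \<le> real (Suc k)" for k x
  proof -
    have "nat \<lceil>x\<rceil> - 1 = k" using that by linarith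
    then show ?thesis using that by (simp add: G_def)
  qed
  have GS: "G (real (Suc k)) = real (cols 0 q ! k)" for k by (rule G) auto
  have "weakly_above (path_curve p) (path_curve q) \<longleftrightarrow> (\<forall>(x, y) \<in> path_curve p. G x \<le> y)"
  proof -
    have "(\<exists>y' \<le> y. (x, y') \<in> path_curve q) \<longleftrightarrow> G x \<le> y" if "(x, y) \<in> path_curve p" for x y
      using that above_path_curve_iff[OF assms(1), of y x 0 0] path_curve_fst_bounds[of x y 0 0 p] assms(2)
      by (simp add: G_def)
    then show ?thesis unfolding weakly_above_def by blast
  qed
  also have "\<dots> \<longleftrightarrow> G 0 \<le> 0 \<and> (\<forall>k < length (cols 0 p). G (real (Suc k)) \<le> real (cols 0 p ! k))"
    using path_curve_above_iff[of G p 0 0] G unfolding GS by simp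
  finally show ?thesis unfolding GS by (simp add: G_def)
qed

text \<open>The line \<open>G\<close> increases, so an east step across a column is tested at the
  right end. Since \<open>p\<close> has no diagonals, the second hypothesis of
  \<open>path_curve_above_iff\<close> is vacuous.\<close>

lemma above_segment_iff:
  assumes "b > 0"
  shows "above_segment a b p \<longleftrightarrow>
    lattice_path a b p \<and> (\<forall>k < b. a * Suc k \<le> b * cols 0 p ! k)"
proof (cases "lattice_path a b p")
  case True
  then have D: "Diag \<notin> set p" and len: "length (cols 0 p) = b"
    by (auto simp: lattice_path_def length_cols count_list_0_iff)
  define G where "G = (\<lambda>x. real a * x / real b)"
  have seg: "(x, y) \<in> closed_segment (0, 0) (real b, real a) \<longleftrightarrow> 0 \<le> x \<and> x \<le> real b \<and> y = G x" for x y
  proof -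
    have "(x, y) \<in> closed_segment (0, 0) (real b, real a) \<longleftrightarrow>
        (\<exists>u. 0 \<le> u \<and> u \<le> 1 \<and> x = u * real b \<and> y = u * real a)"
      by (auto simp: closed_segment_def)
    also have "\<dots> \<longleftrightarrow> 0 \<le> x \<and> x \<le> real b \<and> y = G x"
      using assms by (auto simp: G_def field_simps mult_left_le intro!: exI[of _ "x / real b"])
    finally show ?thesis .
  qed
  have "weakly_above (path_curve p) (closed_segment (0, 0) (real b, real a)) \<longleftrightarrow>
      (\<forall>(x, y) \<in> path_curve p. G x \<le> y)"
  proof -
    have "(\<exists>y' \<le> y. (x, y') \<in> closed_segment (0, 0) (real b, real a)) \<longleftrightarrow> G x \<le> y"
      if "(x, y) \<in> path_curve p" for x y
      using that path_curve_fst_bounds[of x y 0 0 p] len unfolding seg by auto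
    then show ?thesis unfolding weakly_above_def by blast
  qed
  also have "\<dots> \<longleftrightarrow> G 0 \<le> 0 \<and> (\<forall>k < b. G (real (Suc k)) \<le> real (cols 0 p ! k))"
    using path_curve_above_iff[of G p 0 0] D len by (simp add: G_def divide_right_mono mult_left_mono)
  also have "\<dots> \<longleftrightarrow> (\<forall>k < b. a * Suc k \<le> b * cols 0 p ! k)"
  proof -
    have "G (real (Suc k)) \<le> real y \<longleftrightarrow> a * Suc k \<le> b * y" for k y
    proof -
      have "G (real (Suc k)) \<le> real y \<longleftrightarrow> real (a * Suc k) \<le> real (b * y)"
        using assms unfolding G_def of_nat_mult by (simp add: field_simps)
      then show ?thesis by (simp only: of_nat_le_iff)
    qed
    then show ?thesis by (simp add: G_def)
  qed
  finally show ?thesis using True by (simp add: above_segment_def)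
qed (simp add: above_segment_def)

subsection \<open>Encoding of paths by columns\<close>

fun weight :: "nat \<times> bool \<Rightarrow> nat" where
  "weight (d, s) = d + of_bool s"

text \<open>An entry \<open>(d, s)\<close> describes the step across the previous column (diagonal if \<open>s\<close>) followed by
  \<open>d\<close> north steps. For the first entry the previous column is the last one: a Schroeder path ends
  with an east step, and moving this step to the front by the inverse of \<^const>\<open>rotate1\<close> gives an
  encoding whose first entry is unmarked.\<close>

fun encode :: "(nat \<times> bool) list \<Rightarrow> step list" where
  "encode [] = []"
| "encode ((d, s) # zs) = (if s then Diag else East) # replicate d North @ encode zs"

fun decode :: "step list \<Rightarrow> nat \<times> (nat \<times> bool) list" where
  "decode [] = (0, [])"
| "decode (North # p) = (case decode p of (d, zs) \<Rightarrow> (Suc d, zs))"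
| "decode (East # p) = (case decode p of (d, zs) \<Rightarrow> (0, (d, False) # zs))"
| "decode (Diag # p) = (case decode p of (d, zs) \<Rightarrow> (0, (d, True) # zs))"

lemma decode_replicate_North:
  "decode (replicate d North @ p) = (case decode p of (e, zs) \<Rightarrow> (d + e, zs))"
  by (induction d) (auto split: prod.splits)

lemma decode_encode: "decode (encode zs) = (0, zs)"
  by (induction zs rule: encode.induct) (auto simp: decode_replicate_North)

lemma encode_decode: "decode p = (d, zs) \<Longrightarrow> replicate d North @ encode zs = p"
  by (induction p arbitrary: d zs rule: decode.induct) (auto split: prod.splits)

lemma cols_replicate_North: "cols n (replicate d North @ p) = cols (n + d) p"
  by (induction d arbitrary: n) auto

lemma cols_encode:
  "cols n (encode zs @ [East]) = map (\<lambda>k. n + sum_list (map weight (take k zs))) [0..<Suc (length zs)]"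
proof (induction zs arbitrary: n rule: encode.induct)
  case (2 d s zs)
  have "cols n (encode ((d, s) # zs) @ [East]) = n # cols (n + weight (d, s)) (encode zs @ [East])"
    by (simp add: cols_replicate_North ac_simps)
  also have "\<dots> = map (\<lambda>k. n + sum_list (map weight (take k ((d, s) # zs))))
      (0 # map Suc [0..<Suc (length zs)])"
    unfolding 2 by (simp add: o_def ac_simps del: upt_Suc)
  also have "0 # map Suc [0..<Suc (length zs)] = [0..<Suc (length ((d, s) # zs))]"
    unfolding map_Suc_upt by (simp add: upt_rec)
  finally show ?case .
qed simp

lemma count_list_encode:
  "count_list (encode zs) Diag = count_list (map snd zs) True"
  "count_list (encode zs) East = count_list (map snd zs) False"
  "count_list (encode zs) North + count_list (encode zs) Diag = sum_list (map weight zs)"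
proof -
  have *: "count_list (replicate d North) x = (if x = North then d else 0)" for d x
    by (induction d) auto
  show "count_list (encode zs) Diag = count_list (map snd zs) True"
    by (induction zs rule: encode.induct) (auto simp: *)
  show "count_list (encode zs) East = count_list (map snd zs) False"
    by (induction zs rule: encode.induct) (auto simp: *)
  show "count_list (encode zs) North + count_list (encode zs) Diag = sum_list (map weight zs)"
    by (induction zs rule: encode.induct) (auto simp: *)
qed

lemma count_list_True_False: "count_list xs True + count_list xs False = length xs"
  by (induction xs) auto

text \<open>A mark is allowed at the head, and only totals are prescribed; this makes the set closed
  under rotation.\<close>

definition codes :: "nat \<Rightarrow> nat \<Rightarrow> nat \<Rightarrow> (nat \<times> bool) list set" where
  "codes a b i = {zs. length zs = b \<and> sum_list (map weight zs) = a \<and> count_list (map snd zs) True = i}"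

text \<open>After \<open>rotate1\<close>, column \<open>k\<close> starts at the sum of the first
  \<open>Suc k\<close> weights, so this is the column condition for Schroeder paths, stated for
  arbitrary codes.\<close>

definition good :: "nat \<Rightarrow> nat \<Rightarrow> (nat \<times> bool) list \<Rightarrow> bool" where
  "good a b zs \<longleftrightarrow> (\<forall>k < b. a * Suc k \<le> b * sum_list (map weight (take (Suc k) zs)))"

lemma rotate1_encode:
  assumes "zs \<noteq> []" "\<not> snd (hd zs)"
  shows "East # rotate1 (encode zs) = encode zs @ [East]"
  using assms by (cases zs rule: encode.cases) auto

lemma count_list_rotate1: "count_list (rotate1 xs) x = count_list xs x"
  by (cases xs) auto

text \<open>Prepending an east step yields \<open>encode zs @ [East]\<close>, whose columns are
  known; cancelling the extra column at height 0 shifts the index by one.\<close>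

lemma cols_rotate1_encode:
  assumes "zs \<noteq> []" "\<not> snd (hd zs)"
  shows "cols 0 (rotate1 (encode zs)) = map (\<lambda>k. sum_list (map weight (take (Suc k) zs))) [0..<length zs]"
proof -
  have "0 # cols 0 (rotate1 (encode zs)) = cols 0 (East # rotate1 (encode zs))" by simp
  also have "\<dots> = map (\<lambda>k. sum_list (map weight (take k zs))) (0 # map Suc [0..<length zs])"
    unfolding rotate1_encode[OF assms] cols_encode map_Suc_upt by (simp add: upt_rec)
  finally show ?thesis by (simp add: o_def)
qed

section \<open>Column heights of \<open>nu\<close> and the resulting inequalities for Schroeder
  paths\<close>

definition nu_height :: "nat \<Rightarrow> nat \<Rightarrow> nat \<Rightarrow> nat" where
  "nu_height a b k = (a * k + b - 1) div b"

text \<open>\<open>nu_height a b k\<close> is the ceiling of \<open>a * k / b\<close>, the least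
  integer height on or above the line at abscissa \<open>k\<close>.\<close>

lemma nu_height_le_iff:
  assumes "b > 0"
  shows "nu_height a b k \<le> y \<longleftrightarrow> a * k \<le> b * y"
proof -
  have "nu_height a b k \<le> y \<longleftrightarrow> nu_height a b k < Suc y" by auto
  also have "\<dots> \<longleftrightarrow> a * k + b - 1 < Suc y * b"
    unfolding nu_height_def using assms by (rule div_less_iff_less_mult)
  also have "\<dots> \<longleftrightarrow> a * k \<le> b * y"
    using assms by (auto simp: algebra_simps)
  finally show ?thesis .
qed

lemma nu_height_mono: "nu_height a b k \<le> nu_height a b (Suc k)"
  unfolding nu_height_def by (intro div_le_mono) simp

lemma nu_height_0: "b > 0 \<Longrightarrow> nu_height a b 0 = 0"
  by (simp add: nu_height_def)

lemma nu_height_end: "b > 0 \<Longrightarrow> nu_height a b b = a"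
  using div_mult_self3[of b a "b - 1"] by (simp add: nu_height_def)

lemma ex_nu:
  assumes "b > 0"
  obtains p where "lattice_path a b p" "\<And>k. k < b \<Longrightarrow> cols 0 p ! k = nu_height a b (Suc k)"
proof
  define zs where "zs = map (\<lambda>k. (nu_height a b (Suc k) - nu_height a b k, False)) [0..<b]"
  define p where "p = rotate1 (encode zs)"
  have ne: "zs \<noteq> []" "\<not> snd (hd zs)" using assms by (auto simp: zs_def hd_map)
  \<comment> \<open>The differences telescope; \<open>nu_height_mono\<close> keeps the truncated
    subtraction exact.\<close>
  have pre: "sum_list (map weight (take k zs)) = nu_height a b k" if "k \<le> b" for k
    using that
  proof (induction k)
    case (Suc k)
    then show ?case using nu_height_mono[of a b k]
      by (simp add: take_Suc_conv_app_nth zs_def)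
  qed (simp add: nu_height_0 assms)
  have "sum_list (map weight zs) = a"
    using pre[of b] assms by (simp add: zs_def nu_height_end)
  moreover have m: "count_list (map snd zs) True = 0"
    by (auto simp: count_list_0_iff zs_def)
  moreover have "count_list (map snd zs) False = b"
    using m count_list_True_False[of "map snd zs"] by (simp add: zs_def)
  ultimately have c: "count_list p Diag = 0" "count_list p North = a" "count_list p East = b"
    using count_list_encode[of zs] by (auto simp: p_def count_list_rotate1)
  then show "lattice_path a b p"
    unfolding lattice_path_def count_list_0_iff by (auto intro: step.exhaust)
  show "cols 0 p ! k = nu_height a b (Suc k)" if "k < b" for k
    unfolding p_def cols_rotate1_encode[OF ne] using pre[of "Suc k"] that by (simp add: zs_def)
qed

text \<open>The path from \<open>ex_nu\<close> attains the least admissible height in every column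
  at once, so it lies below all competitors; a second such path would have the same columns.\<close>

lemma nu_props:
  assumes "b > 0"
  shows "lattice_path a b (nu a b)" "\<And>k. k < b \<Longrightarrow> cols 0 (nu a b) ! k = nu_height a b (Suc k)"
proof -
  obtain p where p: "lattice_path a b p" "\<And>k. k < b \<Longrightarrow> cols 0 p ! k = nu_height a b (Suc k)"
    using ex_nu[OF assms, of a] by blast
  have seg: "above_segment a b q \<longleftrightarrow> lattice_path a b q \<and> (\<forall>k < b. nu_height a b (Suc k) \<le> cols 0 q ! k)" for q
    using assms by (simp add: above_segment_iff nu_height_le_iff)
  have lat: "Diag \<notin> set q" "length (cols 0 q) = b" if "lattice_path a b q" for q
    using that by (auto simp: lattice_path_def length_cols count_list_0_iff)
  have "nu a b = p"
    unfolding nu_def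
  proof (rule the_equality)
    show "above_segment a b p \<and> (\<forall>q. above_segment a b q \<longrightarrow> weakly_above (path_curve q) (path_curve p))"
      using p lat by (simp add: seg weakly_above_path_iff)
  next
    fix q assume q: "above_segment a b q \<and> (\<forall>r. above_segment a b r \<longrightarrow> weakly_above (path_curve r) (path_curve q))"
    then have "above_segment a b q" "weakly_above (path_curve p) (path_curve q)"
      using p seg by auto
    moreover from this have "lattice_path a b q" by (simp add: seg)
    ultimately have "cols 0 q ! k = cols 0 p ! k" if "k < b" for k
      using p lat that by (simp add: seg weakly_above_path_iff) (meson le_antisym)
    then have "cols 0 q = cols 0 p"
      using lat[of q] lat[of p] p(1) \<open>lattice_path a b q\<close> by (intro nth_equalityI) auto
    then show "q = p"
      using lat p(1) \<open>lattice_path a b q\<close> by (intro lattice_path_eqI) (auto simp: lattice_path_def)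
  qed
  with p show "lattice_path a b (nu a b)" "\<And>k. k < b \<Longrightarrow> cols 0 (nu a b) ! k = nu_height a b (Suc k)"
    by auto
qed

lemma schroeder_path_iff:
  assumes "b > 0"
  shows "schroeder_path a b p \<longleftrightarrow> length (cols 0 p) = b \<and> count_list p North + count_list p Diag = a \<and>
    (\<forall>k < b. a * Suc k \<le> b * cols 0 p ! k)"
proof -
  have nu: "Diag \<notin> set (nu a b)" "length (cols 0 (nu a b)) = b"
    using nu_props(1)[OF assms, of a] by (auto simp: lattice_path_def length_cols count_list_0_iff)
  have "sum_list (map step_vec p) = (real b, real a) \<longleftrightarrow>
      length (cols 0 p) = b \<and> count_list p North + count_list p Diag = a"
    unfolding sum_list_step_vec[of p 0] prod.inject of_nat_eq_iff ..
  moreover have "weakly_above (path_curve p) (path_curve (nu a b)) \<longleftrightarrow>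
      (\<forall>k < b. a * Suc k \<le> b * cols 0 p ! k)" if "length (cols 0 p) = b"
    using that nu nu_props(2)[OF assms, of _ a]
    unfolding nu_height_le_iff[OF assms, symmetric] by (simp add: weakly_above_path_iff)
  ultimately show ?thesis unfolding schroeder_path_def by blast
qed

section \<open>Schroeder paths correspond to good codes with unmarked head\<close>

definition dyck_codes :: "nat \<Rightarrow> nat \<Rightarrow> nat \<Rightarrow> (nat \<times> bool) list set" where
  "dyck_codes a b i = {zs \<in> codes a b i. good a b zs \<and> \<not> snd (hd zs)}"

text \<open>The last column has to start at the final height \<open>a\<close>. If the path ended
  with a north or diagonal step, that column would start at height \<open>a - 1\<close> or
  lower.\<close>

lemma schroeder_path_last:
  assumes "b > 0" "schroeder_path a b p"
  obtains p' where "p = p' @ [East]"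
proof -
  from assms have len: "length (cols 0 p) = b" and cnt: "count_list p North + count_list p Diag = a"
    and h: "\<forall>k < b. a * Suc k \<le> b * cols 0 p ! k"
    unfolding schroeder_path_iff[OF assms(1)] by auto
  have "a * b \<le> b * cols 0 p ! (b - 1)"
    using h[rule_format, of "b - 1"] assms(1) by simp
  then have h: "a \<le> last (cols 0 p)"
    using assms(1) len by (subst last_conv_nth) (auto simp: mult.commute[of a])
  obtain p' s where p: "p = p' @ [s]"
    using len assms(1) by (cases p rule: rev_cases) auto
  have "s = East"
  proof (cases s)
    case North
    then have "cols 0 p' = cols 0 p" by (simp add: p cols_append)
    moreover have "cols 0 p \<noteq> []" using len assms(1) by auto
    ultimately have "last (cols 0 p) \<le> 0 + count_list p' North + count_list p' Diag"
      by (intro cols_upper) (metis last_in_set)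
    then show ?thesis using h cnt p North by simp
  next
    case Diag
    then show ?thesis using h cnt p by (simp add: cols_append)
  qed
  then show ?thesis using p that by blast
qed

lemma bij_betw_schroeder:
  assumes "b > 0"
  shows "bij_betw (\<lambda>zs. rotate1 (encode zs)) (dyck_codes a b i)
    {p. schroeder_path a b p \<and> count_list p Diag = i}"
proof (rule bij_betw_imageI)
  show "inj_on (\<lambda>zs. rotate1 (encode zs)) (dyck_codes a b i)"
    by (intro inj_onI) (metis decode_encode inj_rotate1 injD prod.inject)
  have iff: "rotate1 (encode zs) \<in> {p. schroeder_path a b p \<and> count_list p Diag = i} \<longleftrightarrow> zs \<in> dyck_codes a b i"
    if "zs \<noteq> []" "\<not> snd (hd zs)" for zs
    using that count_list_encode[of zs] count_list_True_False[of "map snd zs"]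
    by (auto simp: schroeder_path_iff[OF assms] dyck_codes_def codes_def good_def
        cols_rotate1_encode length_cols count_list_rotate1)
  have ne: "zs \<noteq> [] \<and> \<not> snd (hd zs)" if "zs \<in> dyck_codes a b i" for zs
    using that assms by (auto simp: dyck_codes_def codes_def)
  show "(\<lambda>zs. rotate1 (encode zs)) ` dyck_codes a b i = {p. schroeder_path a b p \<and> count_list p Diag = i}"
  proof (intro equalityI subsetI)
    fix p assume p: "p \<in> {p. schroeder_path a b p \<and> count_list p Diag = i}"
    then obtain p' where p': "p = p' @ [East]" using schroeder_path_last[OF assms] by blast
    \<comment> \<open>\<open>d\<close> counts the north steps before the first crossing in
      \<open>p'\<close>; they go into the head entry, whose own step is the removed final
      \<open>East\<close>.\<close>
    obtain d zs where "decode p' = (d, zs)" by fastforce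
    then have "rotate1 (encode ((d, False) # zs)) = p"
      using encode_decode[of p' d zs] p' by simp
    then show "p \<in> (\<lambda>zs. rotate1 (encode zs)) ` dyck_codes a b i"
      using iff[of "(d, False) # zs"] p by (intro image_eqI[of _ _ "(d, False) # zs"]) auto
  qed (use iff ne in blast)
qed

subsection \<open>The cycle lemma\<close>

lemma card_bool_lists: "card {xs. length xs = n \<and> count_list xs True = k} = n choose k"
proof (induction n arbitrary: k)
  case 0
  have "{xs. length xs = 0 \<and> count_list xs True = k} = (if k = 0 then {[]} else {})" by auto
  then show ?case by simp
next
  case (Suc n)
  let ?S = "\<lambda>n k. {xs. length xs = n \<and> count_list xs True = k}"
  have fin: "finite (?S n k)" for n k
    by (rule finite_subset[OF _ finite_lists_length_eq[of UNIV n]]) auto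
  have "?S (Suc n) k = (#) False ` ?S n k \<union> (if k = 0 then {} else (#) True ` ?S n (k - 1))"
    by (auto simp: length_Suc_conv image_iff split: if_splits)
  also have "card \<dots> = card (?S n k) + (if k = 0 then 0 else card (?S n (k - 1)))"
    by (subst card_Un_disjoint) (auto simp: fin card_image)
  finally show ?case by (cases k) (auto simp: Suc)
qed

lemma sum_list_weight: "sum_list (map weight zs) = sum_list (map fst zs) + count_list (map snd zs) True"
  by (induction zs) auto

text \<open>The \<open>i\<close> marks contribute \<open>i\<close> to the weight, leaving
  \<open>a - i\<close> north steps to be distributed independently of the positions of the
  marks.\<close>

lemma bij_betw_codes:
  assumes "i \<le> a"
  shows "bij_betw (\<lambda>(ds, ss). zip ds ss)
    ({ds. length ds = b \<and> sum_list ds = a - i} \<times> {ss. length ss = b \<and> count_list ss True = i}) (codes a b i)"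
  by (rule bij_betw_byWitness[where f' = "\<lambda>zs. (map fst zs, map snd zs)"])
    (use assms in \<open>auto simp: codes_def sum_list_weight zip_map_fst_snd\<close>)

lemma card_codes:
  assumes "i \<le> a"
  shows "card (codes a b i) = (b choose i) * ((a - i + b - 1) choose (a - i))"
  unfolding bij_betw_same_card[OF bij_betw_codes[OF assms], symmetric]
  by (simp add: card_cartesian_product card_length_sum_list card_bool_lists)

lemma finite_codes: "finite (codes a b i)"
proof (rule finite_subset)
  show "codes a b i \<subseteq> {zs. set zs \<subseteq> {..a} \<times> UNIV \<and> length zs = b}"
  proof
    fix zs assume zs: "zs \<in> codes a b i"
    have "fst z \<le> a" if "z \<in> set zs" for z
      using member_le_sum_list[of "fst z" "map fst zs"] that zs
      by (auto simp: codes_def sum_list_weight)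
    then show "zs \<in> {zs. set zs \<subseteq> {..a} \<times> UNIV \<and> length zs = b}"
      using zs by (auto simp: codes_def)
  qed
qed (simp add: finite_lists_length_eq)

section \<open>Good rotations: uniqueness, existence and the count\<close>

lemma rotate_codes: "rotate r zs \<in> codes a b i \<longleftrightarrow> zs \<in> codes a b i"
proof -
  have "sum_list (rotate1 xs) = sum_list xs" for xs :: "nat list"
    by (cases xs) auto
  then have "sum_list (rotate r xs) = sum_list xs" for xs :: "nat list"
    by (induction r) auto
  moreover have "count_list (rotate r xs) x = count_list xs x" for xs :: "bool list" and x
    by (induction r) (auto simp: count_list_rotate1)
  ultimately show ?thesis by (simp add: codes_def flip: rotate_map)
qed

text \<open>Goodness of \<open>zs\<close> bounds the weight \<open>S\<close> of the first
  \<open>r\<close> entries from below; goodness of the rotation bounds that of the remaining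
  entries, hence \<open>S\<close> from above. So \<open>b * S = a * r\<close>, and coprimality gives
  that \<open>b\<close> divides \<open>r\<close>.\<close>

lemma good_rotate_unique:
  assumes "coprime a b" "zs \<in> codes a b i" "good a b zs" "good a b (rotate r zs)" "r < b"
  shows "r = 0"
proof (rule ccontr)
  assume "r \<noteq> 0"
  define S where "S = sum_list (map weight (take r zs))"
  have len: "length zs = b" and sum: "sum_list (map weight zs) = a"
    using assms(2) by (auto simp: codes_def)
  have 1: "a * r \<le> b * S"
    using assms(3,5) \<open>r \<noteq> 0\<close> unfolding good_def S_def by (metis Suc_pred less_imp_diff_less neq0_conv)
  have "take (b - r) (rotate r zs) = drop r zs"
    using assms(5) len by (simp add: rotate_drop_take)
  moreover have "S + sum_list (map weight (drop r zs)) = a"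
    unfolding S_def sum[symmetric] by (metis append_take_drop_id map_append sum_list_append)
  moreover have "a * (b - r) \<le> b * sum_list (map weight (take (b - r) (rotate r zs)))"
    using assms(4)[unfolded good_def, rule_format, of "b - r - 1"] assms(5) \<open>r \<noteq> 0\<close>
    by (simp add: Suc_diff_Suc)
  ultimately have "a * (b - r) + b * S \<le> b * a"
    by (metis add.commute add_le_mono1 distrib_left)
  moreover have "a * (b - r) + a * r = b * a"
    using assms(5) by (simp flip: distrib_left)
  ultimately have "b * S \<le> a * r" by linarith
  with 1 have "b * S = a * r" by simp
  then have "b dvd a * r" by (metis dvd_triv_left)
  with assms(1) have "b dvd r" by (metis coprime_commute coprime_dvd_mult_right_iff)
  with \<open>r \<noteq> 0\<close> assms(5) show False by (auto dest: dvd_imp_le)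
qed

text \<open>Rotate to the column where the path is lowest relative to the line of slope \<open>a / b\<close>.\<close>

lemma ex_good_rotate:
  assumes "b > 0" "zs \<in> codes a b i"
  shows "\<exists>r < b. good a b (rotate r zs)"
proof -
  have len: "length zs = b" and sum: "sum_list (map weight zs) = a"
    using assms(2) by (auto simp: codes_def)
  \<comment> \<open>\<open>F\<close> sums the weights of the periodically extended code, and
    \<open>\<phi>\<close> is \<open>b\<close> times its deviation from the line of slope
    \<open>a / b\<close>. As \<open>F b = a\<close>, \<open>\<phi>\<close> has period
    \<open>b\<close>, so a minimum over one period is global.\<close>
  define F where "F n = (\<Sum>j<n. weight (zs ! (j mod b)))" for n
  define \<phi> where "\<phi> n = int b * int (F n) - int a * int n" for n
  have Fb: "F b = a"
    unfolding F_def sum[symmetric] by (simp add: sum_list_sum_nth len lessThan_atLeast0)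
  have Fadd: "F (m + n) = F m + (\<Sum>j<n. weight (zs ! ((m + j) mod b)))" for m n
    by (induction n) (auto simp: F_def)
  have "F (b + n) = a + F n" for n
    unfolding Fadd Fb by (simp add: F_def)
  then have step: "\<phi> (b + n) = \<phi> n" for n
    by (simp add: \<phi>_def distrib_left)
  have per: "\<phi> (n + b * m) = \<phi> n" for n m
  proof (induction m)
    case (Suc m)
    have "n + b * Suc m = b + (n + b * m)" by simp
    then show ?case by (simp only: step Suc)
  qed simp
  define r where "r = arg_min_on \<phi> {..<b}"
  have "r < b" and min: "\<phi> r \<le> \<phi> n" if "n < b" for n
    using that arg_min_if_finite(1)[of "{..<b}" \<phi>] arg_min_least[of "{..<b}" n \<phi>] assms(1)
    by (auto simp: r_def)
  then have r: "r < b" using assms(1) by blast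
  have min': "\<phi> r \<le> \<phi> n" for n
    using min[of "n mod b"] per[of "n mod b" "n div b"] assms(1) by simp
  have "a * Suc k \<le> b * sum_list (map weight (take (Suc k) (rotate r zs)))" if "k < b" for k
  proof -
    have "sum_list (map weight (take (Suc k) (rotate r zs))) = (\<Sum>j<Suc k. weight (zs ! ((r + j) mod b)))"
      using that len by (simp add: sum_list_sum_nth nth_rotate lessThan_atLeast0 add.commute del: sum.op_ivl_Suc)
    then have "F (r + Suc k) = F r + sum_list (map weight (take (Suc k) (rotate r zs)))"
      using Fadd[of r "Suc k"] by simp
    with min'[of "r + Suc k"] have "int (a * Suc k) \<le> int (b * sum_list (map weight (take (Suc k) (rotate r zs))))"
      by (simp add: \<phi>_def algebra_simps)
    then show ?thesis by (simp only: of_nat_le_iff)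
  qed
  with r show ?thesis by (auto simp: good_def)
qed

text \<open>Every code is \<open>rotate r zs\<close> for exactly one pair of a shift
  \<open>r < b\<close> and a good \<open>zs\<close>.\<close>

lemma card_good_codes:
  assumes "b > 0" "coprime a b"
  shows "b * card {zs \<in> codes a b i. good a b zs} = card (codes a b i)"
proof -
  let ?G = "{zs \<in> codes a b i. good a b zs}"
  have len: "length zs = b" if "zs \<in> codes a b i" for zs
    using that by (simp add: codes_def)
  have unrotate: "rotate (b - r) (rotate r zs) = zs" if "zs \<in> codes a b i" "r < b" for zs r
    using that len by (simp add: rotate_rotate)
  have "inj_on (\<lambda>(r, zs). rotate r zs) ({..<b} \<times> ?G)"
  proof (rule inj_onI, clarify)
    fix r zs r' zs'
    assume *: "zs \<in> codes a b i" "good a b zs" "zs' \<in> codes a b i" "good a b zs'"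
      "r < b" "r' < b" "rotate r zs = rotate r' zs'"
    \<comment> \<open>Undoing the rotation by \<open>r'\<close> exhibits \<open>zs'\<close> as a
      rotation of \<open>zs\<close>; both are good, so the reduced shift must be 0.\<close>
    have zs': "rotate ((b - r' + r) mod b) zs = zs'"
      using unrotate[of zs' r'] * len[of zs] rotate_rotate[of "b - r'" r zs]
      by (metis rotate_conv_mod)
    have "(b - r' + r) mod b = 0"
      using good_rotate_unique[of a b zs i "(b - r' + r) mod b"] assms * zs' by simp
    then have "zs = zs'" "b dvd b - r' + r" using zs' by auto
    moreover have "r = r'"
    proof -
      obtain k where k: "b - r' + r = b * k" using \<open>b dvd b - r' + r\<close> by (auto simp: dvd_def)
      moreover have "0 < b - r' + r" "b - r' + r < b * 2" using * by auto
      ultimately have "k = 1" by simp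
      with k * show ?thesis by simp
    qed
    ultimately show "r = r' \<and> zs = zs'" by simp
  qed
  moreover have "(\<lambda>(r, zs). rotate r zs) ` ({..<b} \<times> ?G) = codes a b i"
  proof (intro equalityI subsetI)
    fix zs assume zs: "zs \<in> codes a b i"
    then obtain r where r: "r < b" "good a b (rotate r zs)" using ex_good_rotate[OF assms(1)] by blast
    \<comment> \<open>For \<open>r = 0\<close> the inverse shift \<open>b - r\<close> is
      \<open>b\<close>, outside the range; hence the reduction modulo \<open>b\<close>.\<close>
    have "rotate ((b - r) mod b) (rotate r zs) = zs"
      using unrotate[OF zs r(1)] len[OF zs] by (metis length_rotate rotate_conv_mod)
    then show "zs \<in> (\<lambda>(r, zs). rotate r zs) ` ({..<b} \<times> ?G)"
      using r zs assms(1) by (intro image_eqI[of _ _ "((b - r) mod b, rotate r zs)"]) (auto simp: rotate_codes)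
  qed (auto simp: rotate_codes)
  ultimately have "bij_betw (\<lambda>(r, zs). rotate r zs) ({..<b} \<times> ?G) (codes a b i)"
    by (rule bij_betw_imageI)
  then have "card ({..<b} \<times> ?G) = card (codes a b i)"
    by (rule bij_betw_same_card)
  then show ?thesis by (simp add: card_cartesian_product)
qed

subsection \<open>Counting\<close>

text \<open>Erasing a mark frees one north step, so that the weight does not change.\<close>

definition unmark_hd :: "(nat \<times> bool) list \<Rightarrow> (nat \<times> bool) list" where
  "unmark_hd zs = (Suc (fst (hd zs)), False) # tl zs"

lemma bij_betw_marked:
  assumes "a > 0" "b > 0"
  shows "bij_betw unmark_hd {zs \<in> codes a b (Suc i). good a b zs \<and> snd (hd zs)} (dyck_codes a b i)"
proof (rule bij_betw_byWitness[where f' = "\<lambda>zs. (fst (hd zs) - 1, True) # tl zs"])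
  \<comment> \<open>Goodness at index 0 forces positive weight of the unmarked head, so there is a
    north step to trade for a mark.\<close>
  have pos: "0 < fst (hd zs)" if "zs \<in> dyck_codes a b i" for zs
  proof -
    have "a * Suc 0 \<le> b * sum_list (map weight (take (Suc 0) zs))" "zs \<noteq> []" "\<not> snd (hd zs)"
      using that assms unfolding dyck_codes_def good_def codes_def by auto
    then show ?thesis using assms(1) by (cases zs rule: encode.cases) (auto intro!: gr0I)
  qed
  show "\<forall>zs \<in> dyck_codes a b i. unmark_hd ((fst (hd zs) - 1, True) # tl zs) = zs"
  proof
    fix zs assume "zs \<in> dyck_codes a b i"
    with pos[OF this] assms show "unmark_hd ((fst (hd zs) - 1, True) # tl zs) = zs"
      by (cases zs rule: encode.cases) (auto simp: unmark_hd_def dyck_codes_def codes_def)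
  qed
  show "\<forall>zs \<in> {zs \<in> codes a b (Suc i). good a b zs \<and> snd (hd zs)}.
      (fst (hd (unmark_hd zs)) - 1, True) # tl (unmark_hd zs) = zs"
  proof
    fix zs assume "zs \<in> {zs \<in> codes a b (Suc i). good a b zs \<and> snd (hd zs)}"
    then show "(fst (hd (unmark_hd zs)) - 1, True) # tl (unmark_hd zs) = zs"
      using assms by (cases zs rule: encode.cases) (auto simp: unmark_hd_def codes_def)
  qed
  show "unmark_hd ` {zs \<in> codes a b (Suc i). good a b zs \<and> snd (hd zs)} \<subseteq> dyck_codes a b i"
  proof
    fix zs assume "zs \<in> unmark_hd ` {zs \<in> codes a b (Suc i). good a b zs \<and> snd (hd zs)}"
    then obtain ys where "zs = unmark_hd ys" "ys \<in> codes a b (Suc i)" "good a b ys" "snd (hd ys)" by auto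
    then show "zs \<in> dyck_codes a b i"
      using assms by (cases ys rule: encode.cases) (auto simp: unmark_hd_def dyck_codes_def codes_def good_def)
  qed
  show "(\<lambda>zs. (fst (hd zs) - 1, True) # tl zs) ` dyck_codes a b i
      \<subseteq> {zs \<in> codes a b (Suc i). good a b zs \<and> snd (hd zs)}"
  proof (rule image_subsetI)
    fix zs assume zs: "zs \<in> dyck_codes a b i"
    then obtain d ys where "zs = (Suc d, False) # ys"
      using pos[OF zs] assms by (cases zs rule: encode.cases) (auto simp: dyck_codes_def codes_def gr0_conv_Suc)
    then show "(fst (hd zs) - 1, True) # tl zs \<in> {zs \<in> codes a b (Suc i). good a b zs \<and> snd (hd zs)}"
      using zs by (auto simp: dyck_codes_def codes_def good_def)
  qed
qed

text \<open>Good codes with \<open>Suc i\<close> marks are split by whether the head is marked; the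
  marked ones are counted through \<open>bij_betw_marked\<close>.\<close>

lemma card_dyck_codes_Suc:
  assumes "a > 0" "b > 0" "coprime a b"
  shows "b * (card (dyck_codes a b (Suc i)) + card (dyck_codes a b i)) = card (codes a b (Suc i))"
proof -
  let ?M = "{zs \<in> codes a b (Suc i). good a b zs \<and> snd (hd zs)}"
  have "{zs \<in> codes a b (Suc i). good a b zs} = dyck_codes a b (Suc i) \<union> ?M"
    by (auto simp: dyck_codes_def)
  also have "card \<dots> = card (dyck_codes a b (Suc i)) + card ?M"
    by (rule card_Un_disjoint) (auto simp: dyck_codes_def finite_codes)
  also have "card ?M = card (dyck_codes a b i)"
    by (rule bij_betw_same_card[OF bij_betw_marked[OF assms(1,2)]])
  finally show ?thesis using card_good_codes[OF assms(2,3), of "Suc i"] by simp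
qed

lemma card_dyck_codes_0:
  assumes "b > 0" "coprime a b"
  shows "b * card (dyck_codes a b 0) = card (codes a b 0)"
proof -
  have "\<not> snd (hd zs)" if "zs \<in> codes a b 0" for zs
    using that assms by (cases zs) (auto simp: codes_def split: if_splits)
  then have "dyck_codes a b 0 = {zs \<in> codes a b 0. good a b zs}"
    by (auto simp: dyck_codes_def)
  then show ?thesis using card_good_codes[OF assms] by simp
qed

section \<open>Binomial identities and the closed formulas\<close>

lemma binomial_recurrence:
  assumes "Suc i < a" "b > 0"
  shows "((a - 1) choose Suc i) * ((a + b - 1 - Suc i) choose a) + ((a - 1) choose i) * ((a + b - 1 - i) choose a)
    = (b choose Suc i) * ((a - Suc i + b - 1) choose (a - Suc i))"
proof -
  \<comment> \<open>Factorials settle the first case. For \<open>b = Suc i\<close> the first summand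
    vanishes and symmetry of binomials remains; for \<open>b \<le> i\<close> both sides are
    0.\<close>
  consider "Suc i < b" | "b = Suc i" | "b \<le> i" by linarith
  then show ?thesis
  proof cases
    case 1
    \<comment> \<open>Writing \<open>a\<close> and \<open>b\<close> as \<open>i + 2\<close> plus a
      remainder removes all truncated subtractions.\<close>
    obtain u where u: "a = Suc (Suc i) + u" using assms(1) by (metis less_iff_Suc_add add_Suc add_Suc_right)
    obtain v where v: "b = Suc (Suc i) + v" using 1 by (metis less_iff_Suc_add add_Suc add_Suc_right)
    have "real ((a - 1) choose Suc i) = fact (Suc (i + u)) / (fact (Suc i) * fact u)"
      "real ((a + b - 1 - Suc i) choose a) = fact (Suc (Suc (i + u + v))) / (fact (Suc (Suc (i + u))) * fact v)"
      "real ((a - 1) choose i) = fact (Suc (i + u)) / (fact i * fact (Suc u))"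
      "real ((a + b - 1 - i) choose a) = fact (Suc (Suc (Suc (i + u + v)))) / (fact (Suc (Suc (i + u))) * fact (Suc v))"
      "real (b choose Suc i) = fact (Suc (Suc (i + v))) / (fact (Suc i) * fact (Suc v))"
      "real ((a - Suc i + b - 1) choose (a - Suc i)) = fact (Suc (Suc (i + u + v))) / (fact (Suc u) * fact (Suc (i + v)))"
      unfolding u v by (subst binomial_fact; simp add: ac_simps eval_nat_numeral del: fact_Suc)+
    note eqs = this
    have "real (((a - 1) choose Suc i) * ((a + b - 1 - Suc i) choose a) + ((a - 1) choose i) * ((a + b - 1 - i) choose a))
        = real ((b choose Suc i) * ((a - Suc i + b - 1) choose (a - Suc i)))"
      unfolding of_nat_add of_nat_mult eqs fact_Suc[of "Suc (Suc (i + u + v))"] fact_Suc[of "Suc (i + u)"]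
        fact_Suc[of i] fact_Suc[of u] fact_Suc[of v] fact_Suc[of "Suc (i + v)"]
      by (simp add: divide_simps del: fact_Suc) (simp add: algebra_simps del: fact_Suc)
    then show ?thesis by (simp only: of_nat_eq_iff)
  next
    case 2
    then show ?thesis using assms binomial_symmetric[of i "a - 1"] by simp
  next
    case 3
    then have "b choose Suc i = 0" "(a + b - 1 - Suc i) choose a = 0" "(a + b - 1 - i) choose a = 0"
      using assms by (auto intro!: binomial_eq_0)
    then show ?thesis by (simp only: mult_zero_left mult_zero_right add_0_left)
  qed
qed

text \<open>Both the counts and the formula have known sums of consecutive terms, by
  \<open>card_dyck_codes_Suc\<close> and \<open>binomial_recurrence\<close>; these sums
  agree.\<close>

lemma card_dyck_codes:
  assumes "b > 0" "coprime a b" "i < a"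
  shows "b * card (dyck_codes a b i) = ((a - 1) choose i) * ((a + b - 1 - i) choose a)"
  using assms(3)
proof (induction i)
  case 0
  then show ?case using assms by (simp add: card_dyck_codes_0 card_codes)
next
  case (Suc i)
  have "b * card (dyck_codes a b (Suc i)) + b * card (dyck_codes a b i)
      = (b choose Suc i) * ((a - Suc i + b - 1) choose (a - Suc i))"
    using card_dyck_codes_Suc[of a b i] card_codes[of "Suc i" a b] Suc.prems assms
    by (simp add: distrib_left)
  then show ?case
    using Suc binomial_recurrence[OF Suc.prems assms(1)] by simp
qed

text \<open>For \<open>i < b\<close> both sides equal \<open>fact (a + b - 1 - i) / (fact i * fact
  (a - 1 - i) * fact (b - 1 - i))\<close>, which is symmetric in \<open>a\<close> and
  \<open>b\<close>; otherwise each side has a zero factor.\<close>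

lemma binomial_swap:
  assumes "a > 0" "b > 0" "i < a"
  shows "b * ((b - 1) choose i) * ((a + b - 1 - i) choose b) = a * ((a - 1) choose i) * ((a + b - 1 - i) choose a)"
proof (cases "i < b")
  case True
  obtain u where u: "a = Suc i + u" using assms(3) by (metis less_iff_Suc_add add_Suc)
  obtain v where v: "b = Suc i + v" using True by (metis less_iff_Suc_add add_Suc)
  have "real ((b - 1) choose i) = fact (i + v) / (fact i * fact v)"
    "real ((a + b - 1 - i) choose b) = fact (Suc (i + u + v)) / (fact (Suc (i + v)) * fact u)"
    "real ((a - 1) choose i) = fact (i + u) / (fact i * fact u)"
    "real ((a + b - 1 - i) choose a) = fact (Suc (i + u + v)) / (fact (Suc (i + u)) * fact v)"
    unfolding u v by (subst binomial_fact; simp add: ac_simps eval_nat_numeral del: fact_Suc)+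
  note eqs = this
  have "real (b * ((b - 1) choose i) * ((a + b - 1 - i) choose b)) = real (a * ((a - 1) choose i) * ((a + b - 1 - i) choose a))"
    unfolding of_nat_mult eqs fact_Suc[of "i + v"] fact_Suc[of "i + u"]
    unfolding u v by (simp add: divide_simps del: fact_Suc)
  then show ?thesis by (simp only: of_nat_eq_iff)
next
  case False
  then have "(b - 1) choose i = 0" "(a + b - 1 - i) choose a = 0"
    using assms by (auto intro!: binomial_eq_0)
  then show ?thesis by (simp only: mult_zero_left mult_zero_right add_0_left)
qed

theorem proposition2p14:
  fixes a b i :: nat
  assumes "a > 0" and "b > 0" and "coprime a b" and "i \<le> a - 1"
  shows "real (sch a b i) = 1 / real a * real ((b - 1) choose i) * real ((a + b - 1 - i) choose b)
       \<and> real (sch a b i) = 1 / real b * real ((a - 1) choose i) * real ((a + b - 1 - i) choose a)"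
proof -
  have i: "i < a" using assms by simp
  have "sch a b i = card (dyck_codes a b i)"
    unfolding sch_def using bij_betw_same_card[OF bij_betw_schroeder[OF assms(2)]] by metis
  then have "b * sch a b i = ((a - 1) choose i) * ((a + b - 1 - i) choose a)"
    using card_dyck_codes[OF assms(2,3) i] by simp
  then have 1: "real b * real (sch a b i) = real ((a - 1) choose i) * real ((a + b - 1 - i) choose a)"
    by (metis of_nat_mult)
  have 2: "real b * real ((b - 1) choose i) * real ((a + b - 1 - i) choose b)
      = real a * real ((a - 1) choose i) * real ((a + b - 1 - i) choose a)"
    using binomial_swap[OF assms(1,2) i] by (metis of_nat_mult)
  have "real b * (real a * real (sch a b i)) = real b * (real ((b - 1) choose i) * real ((a + b - 1 - i) choose b))"
    using 1 2 by (metis mult.assoc mult.left_commute)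
  then have 3: "real a * real (sch a b i) = real ((b - 1) choose i) * real ((a + b - 1 - i) choose b)"
    using assms(2) by simp
  have "x = 1 / c * y * z" if "c * x = y * z" "c > 0" for c x y z :: real
    using that by (simp add: field_simps)
  from this[OF 3] this[OF 1] show ?thesis using assms(1,2) by simp
qed

end
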